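(* Let $\mathbb{N}=\{1,2,3,\dots\}$ and let $$P_0=\{(w,x,y,z):(w-1)\oplus(x-1)\oplus(y-1)\oplus(z-1)=0\},$$ $$P_1=\{(w,2n-1,w,2n):w,n\in\mathbb{N}\}\cup\{(w,2n,w,2n-1):w,n\in\mathbb{N}\}\cup\{(2n-1,x,2n,x):x,n\in\mathbb{N}\}\cup\{(2n,x,2n-1,x):x,n\in\mathbb{N}\},$$ $$N_0=\{(2m,2n,2m-1,2n-1):m,n\in\mathbb{N}\}\cup\{(2m,2n-1,2m-1,2n):m,n\in\mathbb{N}\}\cup\{(2m-1,2n-1,2m,2n):m,n\in\mathbb{N}\}\cup\{(2m-1,2n,2m,2n-1):m,n\in\mathbb{N}\}.$$ Consider the two-dimensional Silver Dollar game without push (rules in the context). Among the positions $(w,x,y,z)$ with both coins on the board, i.e. $w,x,y,z\in\mathbb{N}$ and $(w,x)\ne(y,z)$, the set of $\mathcal{P}$-positions is $(P_0\cup P_1)-N_0$.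
   Context: $\oplus$ denotes nim-sum (bitwise XOR of non-negative integers). A position of an impartial game is a $\mathcal{P}$-position if the previous player (the one who has just moved) wins under correct play, and an $\mathcal{N}$-position if the next player to move wins. Play is under the normal convention: a player who cannot move loses. The two-dimensional Silver Dollar game without push. The board is the quarter-infinite chessboard whose squares are the pairs $(a,b)$ of integers $a,b\ge 1$; the first coordinate counts columns from the left and the second counts rows from the top, and a coordinate equal to $0$ means that the coin is off the board. Two coins are placed on distinct squares; $(w,x,y,z)$ denotes the position in which one coin is at $(w,x)$ and the other at $(y,z)$. Two players alternately choose a coin that is on the board and move it either to the left (strictly decreasing its first coordinate, the second being fixed) or upward (strictly decreasing its second coordinate, the first being fixed), as far as desired; the decreased coordinate may become $0$, in which case the coin drops off the board. A coin that has dropped off the board can no longer be used and does not obstruct anything. A coin may jump over the other coin but may not land on the square occupied by the other coin; coins cannot be pushed. The game ends when both coins are off the board. *)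

theory Defs
  imports Main
begin

unbundle bit_operations_syntax

(* Outcome classes of an impartial game with move relation mv under normal play.
   A position without moves is in P_pos by the first rule: the player to move has lost. *)

inductive P_pos :: "('p \<Rightarrow> 'p \<Rightarrow> bool) \<Rightarrow> 'p \<Rightarrow> bool"
  and N_pos :: "('p \<Rightarrow> 'p \<Rightarrow> bool) \<Rightarrow> 'p \<Rightarrow> bool"
  for mv :: "'p \<Rightarrow> 'p \<Rightarrow> bool"
where
  P_posI: "(\<And>q. mv p q \<Longrightarrow> N_pos mv q) \<Longrightarrow> P_pos mv p"
| N_posI: "mv p q \<Longrightarrow> P_pos mv q \<Longrightarrow> N_pos mv p"

type_synonym coin = "nat \<times> nat"
type_synonym position = "nat \<times> nat \<times> nat \<times> nat"

definition on_board :: "coin \<Rightarrow> bool" where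
  "on_board c \<longleftrightarrow> fst c \<ge> 1 \<and> snd c \<ge> 1"

inductive coin_move :: "coin \<Rightarrow> coin \<Rightarrow> bool" where
  left: "on_board (a, b) \<Longrightarrow> a' < a \<Longrightarrow> coin_move (a, b) (a', b)"
| up: "on_board (a, b) \<Longrightarrow> b' < b \<Longrightarrow> coin_move (a, b) (a, b')"

(* Only a target on the board can be blocked: two coins that have both dropped off
   may well end up with the same pair of coordinates. *)
definition blocked :: "coin \<Rightarrow> coin \<Rightarrow> bool" where
  "blocked target other \<longleftrightarrow> on_board target \<and> target = other"

inductive silver_move :: "position \<Rightarrow> position \<Rightarrow> bool" where
  first_coin: "coin_move (w, x) (w', x') \<Longrightarrow> \<not> blocked (w', x') (y, z)
    \<Longrightarrow> silver_move (w, x, y, z) (w', x', y, z)"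
| second_coin: "coin_move (y, z) (y', z') \<Longrightarrow> \<not> blocked (y', z') (w, x)
    \<Longrightarrow> silver_move (w, x, y, z) (w, x, y', z')"

definition two_coin_positions :: "position set" where
  "two_coin_positions =
     {(w, x, y, z). on_board (w, x) \<and> on_board (y, z) \<and> (w, x) \<noteq> (y, z)}"

(* In the following sets every subtraction is from a number that is at least 1,
   so truncated subtraction on nat agrees with integer subtraction. *)

definition P0 :: "position set" where
  "P0 = {(w, x, y, z). w \<ge> 1 \<and> x \<ge> 1 \<and> y \<ge> 1 \<and> z \<ge> 1 \<and>
           (w - 1) XOR (x - 1) XOR (y - 1) XOR (z - 1) = 0}"

definition P1 :: "position set" where
  "P1 = {(w, 2 * n - 1, w, 2 * n) | w n. w \<ge> 1 \<and> n \<ge> 1}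
      \<union> {(w, 2 * n, w, 2 * n - 1) | w n. w \<ge> 1 \<and> n \<ge> 1}
      \<union> {(2 * n - 1, x, 2 * n, x) | x n. x \<ge> 1 \<and> n \<ge> 1}
      \<union> {(2 * n, x, 2 * n - 1, x) | x n. x \<ge> 1 \<and> n \<ge> 1}"

definition N0 :: "position set" where
  "N0 = {(2 * m, 2 * n, 2 * m - 1, 2 * n - 1) | m n. m \<ge> 1 \<and> n \<ge> 1}
      \<union> {(2 * m, 2 * n - 1, 2 * m - 1, 2 * n) | m n. m \<ge> 1 \<and> n \<ge> 1}
      \<union> {(2 * m - 1, 2 * n - 1, 2 * m, 2 * n) | m n. m \<ge> 1 \<and> n \<ge> 1}
      \<union> {(2 * m - 1, 2 * n, 2 * m, 2 * n - 1) | m n. m \<ge> 1 \<and> n \<ge> 1}"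

end

(* A single coin on the board is always an N-position, since it can be dropped off at once.
   So with two coins on the board nobody wants to drop one off, and the game is played with
   both coins staying on the board.  Subtract 1 from all coordinates and let u and v be the
   nim-sums of the two columns and of the two rows.  A move changes exactly one of u, v;
   it can lower either of them to any smaller value, except that (u, v) = (0, 0) is forbidden.
   Hence the P-positions are those with u = v > 1 or {u, v} = {0, 1}, as in misere Nim. *)

theory Submission
  imports Defs
begin

section \<open>Outcome classes and their recognition by a kernel\<close>

lemma P_pos_not_N_pos:
  shows "P_pos mv p \<Longrightarrow> \<not> N_pos mv p"
    and "N_pos mv p \<Longrightarrow> \<not> P_pos mv p"
proof (induction rule: P_pos_N_pos.inducts)
  case (P_posI p)
  then show ?case by (meson N_pos.cases)
next
  case (N_posI p q)
  then show ?case by (meson P_pos.cases)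
qed

text \<open>Induction on \<open>f\<close> puts positions in \<open>K\<close> into
  \<open>P_pos\<close> and the others into \<open>N_pos\<close>; disjointness of the classes gives
  the converse. The invariant \<open>I\<close> confines the argument to legal positions.\<close>

lemma P_pos_iff_kernel:
  fixes f :: "'p \<Rightarrow> nat"
  assumes decreasing: "\<And>p q. mv p q \<Longrightarrow> f q < f p"
    and invariant: "\<And>p q. I p \<Longrightarrow> mv p q \<Longrightarrow> I q"
    and stable: "\<And>p q. I p \<Longrightarrow> K p \<Longrightarrow> mv p q \<Longrightarrow> \<not> K q"
    and absorbing: "\<And>p. I p \<Longrightarrow> \<not> K p \<Longrightarrow> \<exists>q. mv p q \<and> K q"
    and "I p"
  shows "P_pos mv p \<longleftrightarrow> K p"
proof -
  have "I p \<Longrightarrow> (if K p then P_pos mv p else N_pos mv p)"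
  proof (induction "f p" arbitrary: p rule: less_induct)
    case less
    show ?case
    proof (cases "K p")
      case True
      have "N_pos mv q" if "mv p q" for q
        using less.hyps[OF decreasing[OF that] invariant[OF less.prems that]]
          stable[OF less.prems True that] by simp
      with True show ?thesis by (simp add: P_posI)
    next
      case False
      then obtain q where q: "mv p q" "K q"
        using absorbing less.prems by blast
      with less.hyps[OF decreasing[OF q(1)] invariant[OF less.prems q(1)]]
      have "P_pos mv q" by simp
      with False q show ?thesis by (auto intro: N_posI)
    qed
  qed
  with \<open>I p\<close> show ?thesis
    using P_pos_not_N_pos by (metis (full_types))
qed

section \<open>Nim-sum arithmetic by halving\<close>

lemma xor_nat_div_2: "(a XOR b) div 2 = (a div 2) XOR (b div 2)" for a b :: nat
  by (subst xor_nat_rec) simp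

lemma even_xor_nat_iff: "even (a XOR b) \<longleftrightarrow> (even a \<longleftrightarrow> even b)" for a b :: nat
  by (subst xor_nat_rec) simp

lemma div_2_less_imp_less: "a div 2 < b div 2 \<Longrightarrow> a < b" for a b :: nat
  by linarith

lemma div_2_eq_even_odd_imp_less: "a div 2 = b div 2 \<Longrightarrow> even a \<Longrightarrow> odd b \<Longrightarrow> a < b" for a b :: nat
  by presburger

lemma xor_left_cancel_nat: "a XOR (a XOR b) = b" for a b :: nat
  by (simp flip: xor.assoc)

text \<open>The highest bit in which \<open>t\<close> and \<open>a XOR b\<close> differ is set in
  exactly one of \<open>a\<close> and \<open>b\<close>, and adding the difference clears it there.
  Halving moves this bit down to the last place.\<close>

lemma less_xor_cases:
  fixes a b t :: nat
  assumes "t < a XOR b"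
  shows "b XOR t < a \<or> a XOR t < b"
  using assms
proof (induction t arbitrary: a b rule: less_induct)
  case (less t)
  have le: "t div 2 \<le> (a XOR b) div 2"
    using less.prems by (simp add: div_le_mono)
  show ?case
  proof (cases "t div 2 = (a XOR b) div 2")
    case True
    \<comment> \<open>Only the last bit differs: exactly one of \<open>a\<close>, \<open>b\<close>
      is odd, and that one loses its last bit.\<close>
    then have "even t" "odd (a XOR b)"
      using less.prems by presburger+
    moreover have "(b XOR t) div 2 = a div 2" "(a XOR t) div 2 = b div 2"
      using True by (simp_all add: xor_nat_div_2 xor_left_cancel_nat xor.commute xor.left_commute)
    ultimately show ?thesis
      by (metis div_2_eq_even_odd_imp_less even_xor_nat_iff)
  next
    case False
    with le have lt: "t div 2 < (a div 2) XOR (b div 2)"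
      by (simp add: xor_nat_div_2)
    have "(b div 2) XOR (t div 2) < a div 2 \<or> (a div 2) XOR (t div 2) < b div 2"
    proof (cases "t = 0")
      case True
      with lt have "a div 2 \<noteq> b div 2" by auto
      with True show ?thesis by auto
    next
      case False
      with less.IH[OF _ lt] show ?thesis by simp
    qed
    then show ?thesis
      by (auto simp flip: xor_nat_div_2 dest: div_2_less_imp_less)
  qed
qed

text \<open>Turns a decrease of a nim-sum into a decrease of one summand; the witnesses are
  \<open>b XOR t\<close> and \<open>a XOR t\<close>.\<close>

lemma lower_xor:
  fixes a b t :: nat
  assumes "t < a XOR b"
  obtains a' where "a' < a" "a' XOR b = t" | b' where "b' < b" "a XOR b' = t"
  using less_xor_cases[OF assms] by (metis xor_left_cancel_nat xor.commute)

lemma xor_nat_eq_0_iff: "a XOR b = 0 \<longleftrightarrow> a = b" for a b :: nat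
  by (metis xor_left_cancel_nat xor_self_eq xor.right_neutral)

lemma xor_nat_eq_1_iff:
  "a XOR b = 1 \<longleftrightarrow> (\<exists>n. a = 2 * n \<and> b = Suc (2 * n) \<or> a = Suc (2 * n) \<and> b = 2 * n)"
  for a b :: nat
proof
  assume ab: "a XOR b = 1"
  then have "a div 2 = b div 2" "even a \<noteq> even b"
    using xor_nat_div_2[of a b] even_xor_nat_iff[of a b] by (auto simp: xor_nat_eq_0_iff)
  then show "\<exists>n. a = 2 * n \<and> b = Suc (2 * n) \<or> a = Suc (2 * n) \<and> b = 2 * n"
    by presburger
next
  assume "\<exists>n. a = 2 * n \<and> b = Suc (2 * n) \<or> a = Suc (2 * n) \<and> b = 2 * n"
  then show "a XOR b = 1"
    by (subst xor_nat_rec) auto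
qed

section \<open>The kernel on pairs of nim-sums\<close>

definition nim_kernel :: "nat \<Rightarrow> nat \<Rightarrow> bool" where
  "nim_kernel u v \<longleftrightarrow> u = v \<and> u > 1 \<or> u = 0 \<and> v = 1 \<or> u = 1 \<and> v = 0"

text \<open>The kernel is the graph of the involution swapping 0 and 1 and fixing all other numbers,
  so each entry determines the other.\<close>

lemma nim_kernel_changed: "nim_kernel u v \<Longrightarrow> nim_kernel u' v' \<Longrightarrow> u = u' \<longleftrightarrow> v = v'"
  if "u = u' \<or> v = v'"
  using that by (auto simp: nim_kernel_def)

lemma nim_kernel_absorbing:
  assumes "\<not> nim_kernel u v" "(u, v) \<noteq> (0, 0)"
  obtains t where "t < u" "nim_kernel t v" | t where "t < v" "nim_kernel u t"
proof -
  have "(\<exists>t<u. nim_kernel t v) \<or> (\<exists>t<v. nim_kernel u t)"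
  proof (cases "u = v")
    case True
    \<comment> \<open>Lowering one entry of (1, 1) to 0 reaches the kernel.\<close>
    with assms have "u = 1" by (auto simp: nim_kernel_def)
    with True show ?thesis by (auto simp: nim_kernel_def)
  next
    case False
    \<comment> \<open>lower the larger number to the value paired with the smaller one\<close>
    let ?partner = "\<lambda>s. if s = 0 then 1 else if s = 1 then 0 else s :: nat"
    from False assms have "?partner v < u \<and> nim_kernel (?partner v) v
        \<or> ?partner u < v \<and> nim_kernel u (?partner u)"
      by (auto simp: nim_kernel_def)
    then show ?thesis by blast
  qed
  with that show thesis by blast
qed

section \<open>The kernel of the coin game\<close>

fun legal :: "position \<Rightarrow> bool" where
  "legal (w, x, y, z) \<longleftrightarrow> \<not> (on_board (w, x) \<and> (w, x) = (y, z))"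

text \<open>The first disjunct covers the finished games; positions with exactly one coin left stay
  outside.\<close>

fun silver_kernel :: "position \<Rightarrow> bool" where
  "silver_kernel (w, x, y, z) \<longleftrightarrow>
     \<not> on_board (w, x) \<and> \<not> on_board (y, z)
     \<or> on_board (w, x) \<and> on_board (y, z)
       \<and> nim_kernel ((w - 1) XOR (y - 1)) ((x - 1) XOR (z - 1))"

lemma silver_move_decreasing:
  "silver_move p q \<Longrightarrow>
     (case q of (w, x, y, z) \<Rightarrow> w + x + y + z) < (case p of (w, x, y, z) \<Rightarrow> w + x + y + z)"
  by (auto elim!: silver_move.cases coin_move.cases)

lemma legal_silver_move: "legal p \<Longrightarrow> silver_move p q \<Longrightarrow> legal q"
  by (auto elim!: silver_move.cases simp: blocked_def)

lemma xor_left_eq_iff_nat: "a XOR b = a XOR c \<longleftrightarrow> b = c" for a b c :: nat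
  by (metis xor_left_cancel_nat)

lemma xor_right_eq_iff_nat: "b XOR a = c XOR a \<longleftrightarrow> b = c" for a b c :: nat
  by (metis xor_left_cancel_nat xor.commute)

lemma silver_kernel_stable:
  assumes "silver_kernel p" "silver_move p q"
  shows "\<not> silver_kernel q"
proof
  assume q: "silver_kernel q"
  from assms(2) show False
  proof cases
    case (first_coin w x w' x' y z)
    from first_coin(3) have on: "on_board (w, x)"
      and one: "w' < w \<and> x' = x \<or> w' = w \<and> x' < x"
      by (auto elim: coin_move.cases)
    \<comment> \<open>The other coin is still on the board, so \<open>q\<close> can be in the kernel
      only if the moved coin stays on it too.\<close>
    with first_coin assms(1) q
    have "on_board (w', x')" "nim_kernel ((w - 1) XOR (y - 1)) ((x - 1) XOR (z - 1))"
      "nim_kernel ((w' - 1) XOR (y - 1)) ((x' - 1) XOR (z - 1))"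
      by auto
    \<comment> \<open>By cancellation exactly one nim-sum has changed; all coordinates are positive,
      so subtracting 1 keeps distinct values distinct.\<close>
    with nim_kernel_changed[OF _ this(2,3)] on one show False
      by (auto simp: xor_right_eq_iff_nat on_board_def)
  next
    case (second_coin y z y' z' w x)
    from second_coin(3) have on: "on_board (y, z)"
      and one: "y' < y \<and> z' = z \<or> y' = y \<and> z' < z"
      by (auto elim: coin_move.cases)
    with second_coin assms(1) q
    have "on_board (y', z')" "nim_kernel ((w - 1) XOR (y - 1)) ((x - 1) XOR (z - 1))"
      "nim_kernel ((w - 1) XOR (y' - 1)) ((x - 1) XOR (z' - 1))"
      by auto
    with nim_kernel_changed[OF _ this(2,3)] on one show False
      by (auto simp: xor_left_eq_iff_nat on_board_def)
  qed
qed

lemma coin_move_off: "on_board c \<Longrightarrow> \<exists>c'. coin_move c c' \<and> \<not> on_board c'"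
proof (cases c)
  case (Pair a b)
  assume "on_board c"
  with Pair have "coin_move c (0, b)"
    by (auto simp: on_board_def intro: coin_move.left)
  then show ?thesis by (auto simp: on_board_def)
qed

text \<open>Coins on a common square would give the nim-sums (0, 0). Hence a move into the kernel is
  never blocked.\<close>

lemma nim_kernel_not_equal: "nim_kernel (a XOR c) (b XOR d) \<Longrightarrow> (a, b) \<noteq> (c, d)"
  by (auto simp: nim_kernel_def)

lemma silver_kernel_absorbing_on_board:
  assumes "(a, b) \<noteq> (c, d)" "\<not> nim_kernel (a XOR c) (b XOR d)"
  shows "\<exists>q. silver_move (Suc a, Suc b, Suc c, Suc d) q \<and> silver_kernel q"
proof -
  have reach: "\<exists>q. silver_move (Suc a, Suc b, Suc c, Suc d) q \<and> silver_kernel q"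
    if mv: "coin_move (Suc a, Suc b) (Suc a', Suc b') \<and> c' = c \<and> d' = d
        \<or> coin_move (Suc c, Suc d) (Suc c', Suc d') \<and> a' = a \<and> b' = b"
      and ker: "nim_kernel (a' XOR c') (b' XOR d')" for a' b' c' d'
  proof -
    have "silver_move (Suc a, Suc b, Suc c, Suc d) (Suc a', Suc b', Suc c', Suc d')"
      using mv nim_kernel_not_equal[OF ker]
      by (auto simp: blocked_def intro: silver_move.intros)
    moreover have "silver_kernel (Suc a', Suc b', Suc c', Suc d')"
      using ker by (simp add: on_board_def)
    ultimately show ?thesis by blast
  qed
  have mvs: "coin_move (Suc i, Suc j) (Suc i', Suc j)" if "i' < i" for i i' j
    using that by (auto intro: coin_move.intros simp: on_board_def)
  have mvs': "coin_move (Suc i, Suc j) (Suc i, Suc j')" if "j' < j" for i j j'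
    using that by (auto intro: coin_move.intros simp: on_board_def)
  \<comment> \<open>Distinct squares exclude the one pair outside the kernel that has no smaller
    entry to move to.\<close>
  have "(a XOR c, b XOR d) \<noteq> (0, 0)"
    using assms(1) by (simp add: xor_nat_eq_0_iff)
  with assms(2) show ?thesis
  proof (cases rule: nim_kernel_absorbing)
    case (1 t)
    \<comment> \<open>The two cases of \<open>lower_xor\<close> decide which coin moves
      left.\<close>
    from 1(1) show ?thesis
      by (rule lower_xor) (use 1(2) mvs reach in blast)+
  next
    case (2 t)
    from 2(1) show ?thesis
      by (rule lower_xor) (use 2(2) mvs' reach in blast)+
  qed
qed

lemma silver_kernel_absorbing:
  assumes "legal p" "\<not> silver_kernel p"
  shows "\<exists>q. silver_move p q \<and> silver_kernel q"
proof -
  obtain w x y z where p: "p = (w, x, y, z)" by (cases p)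
  consider "on_board (w, x)" "on_board (y, z)"
    | "on_board (w, x)" "\<not> on_board (y, z)" | "\<not> on_board (w, x)" "on_board (y, z)"
    using assms(2) p by auto
  then show ?thesis
  proof cases
    case 1
    then obtain a b c d where "w = Suc a" "x = Suc b" "y = Suc c" "z = Suc d"
      by (auto simp: on_board_def Suc_le_eq gr0_conv_Suc)
    with 1 assms p silver_kernel_absorbing_on_board[of a b c d] show ?thesis
      by auto
  next
    case 2
    \<comment> \<open>Dropping the last coin ends the game, and a target off the board is never
      blocked.\<close>
    obtain c where "coin_move (w, x) c" "\<not> on_board c"
      using coin_move_off 2(1) by blast
    with 2 p show ?thesis
      by (cases c) (force intro: silver_move.first_coin simp: blocked_def)
  next
    case 3
    obtain c where "coin_move (y, z) c" "\<not> on_board c"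
      using coin_move_off 3(2) by blast
    with 3 p show ?thesis
      by (cases c) (force intro: silver_move.second_coin simp: blocked_def)
  qed
qed

lemma P_pos_silver_move_iff: "legal p \<Longrightarrow> P_pos silver_move p \<longleftrightarrow> silver_kernel p"
  using silver_move_decreasing legal_silver_move silver_kernel_stable silver_kernel_absorbing
  by (rule P_pos_iff_kernel)

section \<open>Translation into the sets \<open>P0\<close>, \<open>P1\<close> and
  \<open>N0\<close>\<close>

definition paired :: "nat \<Rightarrow> nat \<Rightarrow> bool" where
  "paired i j \<longleftrightarrow> (\<exists>n\<ge>1. i = 2 * n - 1 \<and> j = 2 * n \<or> i = 2 * n \<and> j = 2 * n - 1)"

text \<open>Lowered by 1, the members of a pair {2n-1, 2n} differ in the last bit only.\<close>

lemma paired_iff_xor: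
  assumes "i \<ge> 1" "j \<ge> 1"
  shows "paired i j \<longleftrightarrow> (i - 1) XOR (j - 1) = 1"
proof -
  \<comment> \<open>Reindexing by \<open>Suc n\<close> removes the truncated subtraction.\<close>
  have ex_pos: "(\<exists>n\<ge>1. P n) \<longleftrightarrow> (\<exists>n. P (Suc n))" for P :: "nat \<Rightarrow> bool"
    by (metis One_nat_def Suc_le_D le_add1 plus_1_eq_Suc)
  have "paired i j \<longleftrightarrow> (\<exists>n. i = Suc (2 * n) \<and> j = Suc (Suc (2 * n))
      \<or> i = Suc (Suc (2 * n)) \<and> j = Suc (2 * n))"
    unfolding paired_def ex_pos by simp
  also have "\<dots> \<longleftrightarrow> (i - 1) XOR (j - 1) = 1"
    using assms unfolding xor_nat_eq_1_iff by (cases i; cases j) auto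
  finally show ?thesis .
qed

lemma P1_iff:
  "(w, x, y, z) \<in> P1 \<longleftrightarrow>
     w = y \<and> w \<ge> 1 \<and> paired x z \<or> x = z \<and> x \<ge> 1 \<and> paired w y"
  unfolding P1_def paired_def Un_iff mem_Collect_eq prod.inject by auto

lemma N0_iff: "(w, x, y, z) \<in> N0 \<longleftrightarrow> paired w y \<and> paired x z"
  unfolding N0_def paired_def Un_iff mem_Collect_eq prod.inject by auto

theorem theorem3:
  shows "{p \<in> two_coin_positions. P_pos silver_move p}
       = two_coin_positions \<inter> ((P0 \<union> P1) - N0)"
proof -
  have "P_pos silver_move p \<longleftrightarrow> p \<in> (P0 \<union> P1) - N0" if "p \<in> two_coin_positions" for p
  proof -
    obtain w x y z where p: "p = (w, x, y, z)" by (cases p)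
    with that have pos: "w \<ge> 1" "x \<ge> 1" "y \<ge> 1" "z \<ge> 1" and ne: "(w, x) \<noteq> (y, z)"
      by (auto simp: two_coin_positions_def on_board_def)
    define u where "u = (w - 1) XOR (y - 1)"
    define v where "v = (x - 1) XOR (z - 1)"
    have zero: "w = y \<longleftrightarrow> u = 0" "x = z \<longleftrightarrow> v = 0"
      using pos by (auto simp: u_def v_def xor_nat_eq_0_iff)
    have one: "paired w y \<longleftrightarrow> u = 1" "paired x z \<longleftrightarrow> v = 1"
      using pos by (simp_all add: paired_iff_xor u_def v_def)
    have "(w - 1) XOR (x - 1) XOR (y - 1) XOR (z - 1) = u XOR v"
      unfolding u_def v_def by (simp add: ac_simps)
    then have "p \<in> P0 \<longleftrightarrow> u XOR v = 0"
      unfolding P0_def p using pos by simp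
    then have "p \<in> P0 \<longleftrightarrow> u = v"
      unfolding xor_nat_eq_0_iff .
    moreover have "p \<in> P1 \<longleftrightarrow> u = 0 \<and> v = 1 \<or> u = 1 \<and> v = 0"
      unfolding p P1_iff zero one using pos by blast
    moreover have "p \<in> N0 \<longleftrightarrow> u = 1 \<and> v = 1"
      unfolding p N0_iff one ..
    moreover have "\<not> (u = 0 \<and> v = 0)"
      using ne zero by simp
    \<comment> \<open>From the diagonal u = v, distinctness removes (0, 0) and \<open>N0\<close>
      removes (1, 1); \<open>P1\<close> adds (0, 1) and (1, 0).\<close>
    ultimately have "p \<in> (P0 \<union> P1) - N0 \<longleftrightarrow> nim_kernel u v"
      unfolding nim_kernel_def Diff_iff Un_iff by presburger
    moreover have "silver_kernel p \<longleftrightarrow> nim_kernel u v" "legal p"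
      using p pos ne by (auto simp: on_board_def u_def v_def)
    ultimately show ?thesis
      using P_pos_silver_move_iff by blast
  qed
  then show ?thesis by blast
qed

end
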